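(* The category $\mathbf{Gam}$ of games (with variable sets of players) is complete and cocomplete (i.e. it has small products and equalizers, and small coproducts and coequalizers).
   Context: An object (game) of the category $\mathbf{Gam}$ is $G = \langle I, O, \{R_i\}_{i \in I}, \{\preceq_i\}_{i \in I} \rangle$, where $I$ is a set (of players) and $O$ is a set (of outcomes), both possibly empty, and for each $i\in I$, $R_i\subseteq O\times O$ is a reflexive and symmetric relation (accessibility) and $\preceq_i\subseteq O\times O$ is a preorder, i.e. a reflexive and transitive relation (preferences). A morphism $f:G\to G'$, where $G' = \langle J, O', \{R'_j\}_{j \in J}, \{\preceq'_j\}_{j \in J} \rangle$, is a pair $f=(f_p,f_O)$ of functions $f_p:I\to J$ and $f_O:O\to O'$ such that for all $i\in I$ and $o,p\in O$: $oR_ip$ implies $f_O(o)R'_{f_p(i)}f_O(p)$, and $o\preceq_i p$ implies $f_O(o)\preceq'_{f_p(i)} f_O(p)$. Composition and identities are componentwise. *)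

theory Defs
  imports Main "HOL-Library.FuncSet" "HOL-Library.Equipollence"
begin

section \<open>Categories, limits and colimits\<close>

text \<open>Hom-sets of different pairs of objects may overlap, so composition takes the three objects
  as arguments: \<open>Comp C a b c g f\<close> is \<open>g \<circ> f\<close> for \<open>f : a \<rightarrow> b\<close> and \<open>g : b \<rightarrow> c\<close>.\<close>

record ('o, 'm) category =
  Obj :: "'o set"
  Hom :: "'o \<Rightarrow> 'o \<Rightarrow> 'm set"
  Ident :: "'o \<Rightarrow> 'm"
  Comp :: "'o \<Rightarrow> 'o \<Rightarrow> 'o \<Rightarrow> 'm \<Rightarrow> 'm \<Rightarrow> 'm"

definition is_category :: "('o, 'm) category \<Rightarrow> bool" where
  "is_category C \<longleftrightarrow>
     (\<forall>a\<in>Obj C. Ident C a \<in> Hom C a a) \<and>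
     (\<forall>a\<in>Obj C. \<forall>b\<in>Obj C. \<forall>c\<in>Obj C. \<forall>f\<in>Hom C a b. \<forall>g\<in>Hom C b c.
        Comp C a b c g f \<in> Hom C a c) \<and>
     (\<forall>a\<in>Obj C. \<forall>b\<in>Obj C. \<forall>f\<in>Hom C a b.
        Comp C a a b f (Ident C a) = f \<and> Comp C a b b (Ident C b) f = f) \<and>
     (\<forall>a\<in>Obj C. \<forall>b\<in>Obj C. \<forall>c\<in>Obj C. \<forall>d\<in>Obj C.
        \<forall>f\<in>Hom C a b. \<forall>g\<in>Hom C b c. \<forall>h\<in>Hom C c d.
          Comp C a c d h (Comp C a b c g f) = Comp C a b d (Comp C b c d h g) f)"

definition is_product ::
  "('o, 'm) category \<Rightarrow> 'k set \<Rightarrow> ('k \<Rightarrow> 'o) \<Rightarrow> 'o \<Rightarrow> ('k \<Rightarrow> 'm) \<Rightarrow> bool" where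
  "is_product C K G P \<pi> \<longleftrightarrow>
     P \<in> Obj C \<and> (\<forall>k\<in>K. \<pi> k \<in> Hom C P (G k)) \<and>
     (\<forall>X\<in>Obj C. \<forall>f. (\<forall>k\<in>K. f k \<in> Hom C X (G k)) \<longrightarrow>
        (\<exists>!h. h \<in> Hom C X P \<and> (\<forall>k\<in>K. Comp C X P (G k) (\<pi> k) h = f k)))"

definition is_coproduct ::
  "('o, 'm) category \<Rightarrow> 'k set \<Rightarrow> ('k \<Rightarrow> 'o) \<Rightarrow> 'o \<Rightarrow> ('k \<Rightarrow> 'm) \<Rightarrow> bool" where
  "is_coproduct C K G S \<iota> \<longleftrightarrow>
     S \<in> Obj C \<and> (\<forall>k\<in>K. \<iota> k \<in> Hom C (G k) S) \<and>
     (\<forall>X\<in>Obj C. \<forall>f. (\<forall>k\<in>K. f k \<in> Hom C (G k) X) \<longrightarrow>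
        (\<exists>!h. h \<in> Hom C S X \<and> (\<forall>k\<in>K. Comp C (G k) S X h (\<iota> k) = f k)))"

definition is_equalizer ::
  "('o, 'm) category \<Rightarrow> 'o \<Rightarrow> 'o \<Rightarrow> 'm \<Rightarrow> 'm \<Rightarrow> 'o \<Rightarrow> 'm \<Rightarrow> bool" where
  "is_equalizer C a b f g E e \<longleftrightarrow>
     E \<in> Obj C \<and> e \<in> Hom C E a \<and> Comp C E a b f e = Comp C E a b g e \<and>
     (\<forall>X\<in>Obj C. \<forall>u\<in>Hom C X a. Comp C X a b f u = Comp C X a b g u \<longrightarrow>
        (\<exists>!h. h \<in> Hom C X E \<and> Comp C X E a e h = u))"

definition is_coequalizer ::
  "('o, 'm) category \<Rightarrow> 'o \<Rightarrow> 'o \<Rightarrow> 'm \<Rightarrow> 'm \<Rightarrow> 'o \<Rightarrow> 'm \<Rightarrow> bool" where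
  "is_coequalizer C a b f g Q q \<longleftrightarrow>
     Q \<in> Obj C \<and> q \<in> Hom C b Q \<and> Comp C a b Q q f = Comp C a b Q q g \<and>
     (\<forall>X\<in>Obj C. \<forall>u\<in>Hom C b X. Comp C a b X u f = Comp C a b X u g \<longrightarrow>
        (\<exists>!h. h \<in> Hom C Q X \<and> Comp C b Q X h q = u))"

definition has_products :: "('o, 'm) category \<Rightarrow> 'k set \<Rightarrow> bool" where
  "has_products C K \<longleftrightarrow>
     (\<forall>G. (\<forall>k\<in>K. G k \<in> Obj C) \<longrightarrow> (\<exists>P \<pi>. is_product C K G P \<pi>))"

definition has_coproducts :: "('o, 'm) category \<Rightarrow> 'k set \<Rightarrow> bool" where
  "has_coproducts C K \<longleftrightarrow>
     (\<forall>G. (\<forall>k\<in>K. G k \<in> Obj C) \<longrightarrow> (\<exists>S \<iota>. is_coproduct C K G S \<iota>))"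

definition has_equalizers :: "('o, 'm) category \<Rightarrow> bool" where
  "has_equalizers C \<longleftrightarrow>
     (\<forall>a\<in>Obj C. \<forall>b\<in>Obj C. \<forall>f\<in>Hom C a b. \<forall>g\<in>Hom C a b. \<exists>E e. is_equalizer C a b f g E e)"

definition has_coequalizers :: "('o, 'm) category \<Rightarrow> bool" where
  "has_coequalizers C \<longleftrightarrow>
     (\<forall>a\<in>Obj C. \<forall>b\<in>Obj C. \<forall>f\<in>Hom C a b. \<forall>g\<in>Hom C a b. \<exists>Q q. is_coequalizer C a b f g Q q)"

text \<open>The parameter \<open>idx\<close> is the collection of small index sets.\<close>

definition complete_category :: "'k set set \<Rightarrow> ('o, 'm) category \<Rightarrow> bool" where
  "complete_category idx C \<longleftrightarrow> (\<forall>K\<in>idx. has_products C K) \<and> has_equalizers C"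

definition cocomplete_category :: "'k set set \<Rightarrow> ('o, 'm) category \<Rightarrow> bool" where
  "cocomplete_category idx C \<longleftrightarrow> (\<forall>K\<in>idx. has_coproducts C K) \<and> has_coequalizers C"


section \<open>Small sets\<close>

text \<open>
  HOL has no type of all sets, so smallness is relative to a universe, here a collection \<open>small\<close> of
  sets over a type \<open>'u\<close> closed, up to bijection, under subsets, images, and disjoint unions and
  products indexed by the members of \<open>idx\<close>. With \<open>idx = small\<close> these are the usual closure
  properties of a Grothendieck universe: see \<open>universe_inaccessible\<close>.
  Keeping \<open>idx\<close> separate costs nothing and makes infinite index sets available without assuming an
  inaccessible cardinal: by \<open>universe_power\<close>, \<open>small\<close> may consist of all sets over \<open>'u\<close> and \<open>idx\<close>
  of all \<open>K\<close> such that there are at most as many functions from \<open>K\<close> to \<open>'u\<close> as elements of \<open>'u\<close>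
  (e.g. all countable \<open>K\<close>, if \<open>'u\<close> is \<open>nat \<Rightarrow> bool\<close>).
\<close>

locale universe =
  fixes small :: "'u set set" and idx :: "'k set set"
  assumes small_subset: "A \<in> small \<Longrightarrow> B \<subseteq> A \<Longrightarrow> B \<in> small"
    and small_image: "A \<in> small \<Longrightarrow> f ` A \<in> small"
    and small_sum: "K \<in> idx \<Longrightarrow> (\<And>k. k \<in> K \<Longrightarrow> F k \<in> small) \<Longrightarrow> \<exists>B\<in>small. Sigma K F \<approx> B"
    and small_prod: "K \<in> idx \<Longrightarrow> (\<And>k. k \<in> K \<Longrightarrow> F k \<in> small) \<Longrightarrow> \<exists>B\<in>small. Pi\<^sub>E K F \<approx> B"

lemma lepoll_UNIV_D:
  assumes "A \<lesssim> (UNIV :: 'u set)"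
  shows "\<exists>B::'u set. A \<approx> B"
  using assms by (meson inj_on_image_eqpoll_self lepoll_def eqpoll_sym)

lemma universe_power:
  assumes "infinite (UNIV :: 'u set)"
  shows "universe (UNIV :: 'u set set) {K :: 'k set. (K \<rightarrow>\<^sub>E (UNIV :: 'u set)) \<lesssim> (UNIV :: 'u set)}"
proof
  fix K :: "'k set" and A :: "'k \<Rightarrow> 'u set"
  assume "K \<in> {K. (K \<rightarrow>\<^sub>E (UNIV :: 'u set)) \<lesssim> (UNIV :: 'u set)}"
  then have K: "(K \<rightarrow>\<^sub>E (UNIV :: 'u set)) \<lesssim> (UNIV :: 'u set)" by simp
  have "Pi\<^sub>E K A \<subseteq> K \<rightarrow>\<^sub>E UNIV" by auto
  then have "Pi\<^sub>E K A \<lesssim> (UNIV :: 'u set)"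
    using lepoll_trans[OF subset_imp_lepoll K] by auto
  then show "\<exists>B\<in>UNIV. Pi\<^sub>E K A \<approx> (B :: 'u set)" by (simp add: lepoll_UNIV_D)
  obtain a b :: 'u where ab: "a \<noteq> b"
    using assms by (metis (full_types) finite.simps UNIV_eq_I insertI1)
  define \<phi> where "\<phi> k = restrict (\<lambda>j. if j = k then a else b) K" for k
  have "inj_on \<phi> K"
  proof (rule inj_onI)
    fix j k assume jk: "j \<in> K" "k \<in> K" "\<phi> j = \<phi> k"
    then have "\<phi> j j = \<phi> k j" by simp
    with jk(1,2) ab show "j = k" by (simp add: \<phi>_def split: if_splits)
  qed
  moreover have "\<phi> ` K \<subseteq> K \<rightarrow>\<^sub>E UNIV" by (auto simp: \<phi>_def)
  ultimately have "K \<lesssim> (K \<rightarrow>\<^sub>E (UNIV :: 'u set))"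
    unfolding lepoll_def by blast
  then have "K \<lesssim> (UNIV :: 'u set)"
    using K by (rule lepoll_trans)
  then have "K \<times> (UNIV :: 'u set) \<lesssim> (UNIV :: 'u set) \<times> (UNIV :: 'u set)"
    by (intro times_lepoll_mono lepoll_refl)
  also have "(UNIV :: 'u set) \<times> (UNIV :: 'u set) \<lesssim> (UNIV :: 'u set)"
    by (rule eqpoll_imp_lepoll[OF iffD2[OF eqpoll_iff_card_of_ordIso card_of_Times_same_infinite[OF assms]]])
  finally have KU: "K \<times> (UNIV :: 'u set) \<lesssim> (UNIV :: 'u set)" .
  have "Sigma K A \<lesssim> (UNIV :: 'u set)"
    by (rule lepoll_trans[OF subset_imp_lepoll KU]) auto
  then show "\<exists>B\<in>UNIV. Sigma K A \<approx> (B :: 'u set)" by (simp add: lepoll_UNIV_D)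
qed auto

lemma universe_inaccessible:
  fixes small :: "'u set set"
  assumes small: "small = {A. A \<prec> (UNIV :: 'u set)}"
    and regular: "\<And>(K :: 'u set) (A :: 'u \<Rightarrow> 'u set).
      K \<prec> (UNIV :: 'u set) \<Longrightarrow> (\<And>k. k \<in> K \<Longrightarrow> A k \<prec> (UNIV :: 'u set)) \<Longrightarrow> Sigma K A \<prec> (UNIV :: 'u set)"
    and strong_limit: "\<And>A :: 'u set. A \<prec> (UNIV :: 'u set) \<Longrightarrow> Pow A \<prec> (UNIV :: 'u set)"
  shows "universe small small"
proof
  have ex: "\<exists>B\<in>small. S \<approx> B" if S: "S \<prec> (UNIV :: 'u set)" for S :: "'z set"
  proof -
    obtain B :: "'u set" where B: "S \<approx> B"
      using lepoll_UNIV_D[of S] S lesspoll_imp_lepoll by blast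
    then have "B \<prec> (UNIV :: 'u set)"
      using eq_lesspoll_trans[OF eqpoll_sym[OF B] S] by simp
    then show ?thesis using B small by blast
  qed
  show "B \<in> small" if "A \<in> small" "B \<subseteq> A" for A B
    using lesspoll_trans1[OF subset_imp_lepoll[OF that(2)]] that(1) small by simp
  show "f ` A \<in> small" if "A \<in> small" for A f
    using lesspoll_trans1[OF image_lepoll] that small by simp
  fix K :: "'u set" and A :: "'u \<Rightarrow> 'u set"
  assume KA: "K \<in> small" "\<And>k. k \<in> K \<Longrightarrow> A k \<in> small"
  then have sum: "Sigma K A \<prec> (UNIV :: 'u set)"
    using regular[of K A] small by simp
  then show "\<exists>B\<in>small. Sigma K A \<approx> B" by (rule ex)
  obtain B where B: "B \<in> small" "Sigma K A \<approx> B" using ex[OF sum] by blast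
  have "inj_on (\<lambda>x. {(k, x k) | k. k \<in> K}) (Pi\<^sub>E K A)"
  proof (rule inj_onI)
    fix x y assume xy: "x \<in> Pi\<^sub>E K A" "y \<in> Pi\<^sub>E K A" "{(k, x k) | k. k \<in> K} = {(k, y k) | k. k \<in> K}"
    then have "x k = y k" if "k \<in> K" for k using that by blast
    then show "x = y" using xy by (meson PiE_ext)
  qed
  moreover have "(\<lambda>x. {(k, x k) | k. k \<in> K}) ` Pi\<^sub>E K A \<subseteq> Pow (Sigma K A)"
    by auto
  ultimately have "Pi\<^sub>E K A \<lesssim> Pow (Sigma K A)"
    unfolding lepoll_def by blast
  also have "Pow (Sigma K A) \<lesssim> Pow B"
  proof (rule eqpoll_imp_lepoll)
    show "Pow (Sigma K A) \<approx> Pow B"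
      using B(2) bij_betw_Pow unfolding eqpoll_def by blast
  qed
  finally have "Pi\<^sub>E K A \<lesssim> Pow B" .
  moreover have "Pow B \<prec> (UNIV :: 'u set)" using B(1) small strong_limit[of B] by simp
  ultimately show "\<exists>B\<in>small. Pi\<^sub>E K A \<approx> B"
    using ex[OF lesspoll_trans1] by blast
qed


section \<open>The category of games\<close>

record 'u game =
  players :: "'u set"
  outcomes :: "'u set"
  accs :: "'u \<Rightarrow> 'u rel"
  pref :: "'u \<Rightarrow> 'u rel"

text \<open>\<open>accs G i\<close> is the accessibility relation and \<open>pref G i\<close> the preference preorder of player \<open>i\<close>.
  The two relations are families indexed by the players; the last conjunct fixes the irrelevant
  values outside the set of players, so that games are equal iff their components are.\<close>

definition is_game :: "'u game \<Rightarrow> bool" where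
  "is_game G \<longleftrightarrow>
     (\<forall>i\<in>players G.
        accs G i \<subseteq> outcomes G \<times> outcomes G \<and> refl_on (outcomes G) (accs G i) \<and>
        sym (accs G i) \<and> preorder_on (outcomes G) (pref G i)) \<and>
     (\<forall>i. i \<notin> players G \<longrightarrow> accs G i = {} \<and> pref G i = {})"

text \<open>The extensional function space makes morphisms equal iff they agree on players and outcomes.\<close>

definition game_hom :: "'u game \<Rightarrow> 'u game \<Rightarrow> (('u \<Rightarrow> 'u) \<times> ('u \<Rightarrow> 'u)) set" where
  "game_hom G G' =
     {(fp, fo). fp \<in> players G \<rightarrow>\<^sub>E players G' \<and> fo \<in> outcomes G \<rightarrow>\<^sub>E outcomes G' \<and>
        (\<forall>i\<in>players G. \<forall>x\<in>outcomes G. \<forall>y\<in>outcomes G.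
           ((x, y) \<in> accs G i \<longrightarrow> (fo x, fo y) \<in> accs G' (fp i)) \<and>
           ((x, y) \<in> pref G i \<longrightarrow> (fo x, fo y) \<in> pref G' (fp i)))}"

definition Gam :: "'u set set \<Rightarrow> ('u game, ('u \<Rightarrow> 'u) \<times> ('u \<Rightarrow> 'u)) category" where
  "Gam small =
     \<lparr>Obj = {G. is_game G \<and> players G \<in> small \<and> outcomes G \<in> small},
      Hom = game_hom,
      Ident = (\<lambda>G. (restrict id (players G), restrict id (outcomes G))),
      Comp = (\<lambda>G G' G'' g f.
        (compose (players G) (fst g) (fst f), compose (outcomes G) (snd g) (snd f)))\<rparr>"

lemma game_homD:
  assumes "f \<in> game_hom G G'"
  shows "fst f \<in> players G \<rightarrow>\<^sub>E players G'" "snd f \<in> outcomes G \<rightarrow>\<^sub>E outcomes G'"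
  using assms by (auto simp: game_hom_def)

lemma is_category_Gam: "is_category (Gam small)"
proof -
  have unit: "compose A u (restrict id A) = u" "compose A (restrict id B) u = u"
    if "u \<in> A \<rightarrow>\<^sub>E B" for u :: "'a \<Rightarrow> 'a" and A B
    using PiE_mem[OF that] PiE_arb[OF that] by (auto simp: compose_def restrict_def)
  have assoc: "compose A w (compose A v u) = compose A (compose B w v) u"
    if "u \<in> A \<rightarrow>\<^sub>E B" for u v w :: "'a \<Rightarrow> 'a" and A B
    using that by (intro compose_assoc) (simp add: PiE_iff)
  show ?thesis
    unfolding is_category_def Gam_def category.simps
  proof (intro conjI ballI)
    fix a b c d :: "'a game" and f g h :: "('a \<Rightarrow> 'a) \<times> ('a \<Rightarrow> 'a)"
    show "(restrict id (players a), restrict id (outcomes a)) \<in> game_hom a a"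
      by (auto simp: game_hom_def)
    assume f: "f \<in> game_hom a b"
    show "(compose (players a) (fst f) (fst (restrict id (players a), restrict id (outcomes a))),
           compose (outcomes a) (snd f) (snd (restrict id (players a), restrict id (outcomes a)))) = f"
      using game_homD[OF f] by (simp add: unit)
    show "(compose (players a) (fst (restrict id (players b), restrict id (outcomes b))) (fst f),
           compose (outcomes a) (snd (restrict id (players b), restrict id (outcomes b))) (snd f)) = f"
      using game_homD[OF f] by (simp add: unit)
    show "(compose (players a) (fst h)
             (fst (compose (players a) (fst g) (fst f), compose (outcomes a) (snd g) (snd f))),
           compose (outcomes a) (snd h)
             (snd (compose (players a) (fst g) (fst f), compose (outcomes a) (snd g) (snd f)))) =
          (compose (players a)
             (fst (compose (players b) (fst h) (fst g), compose (outcomes b) (snd h) (snd g))) (fst f),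
           compose (outcomes a)
             (snd (compose (players b) (fst h) (fst g), compose (outcomes b) (snd h) (snd g))) (snd f))"
      unfolding fst_conv snd_conv
      by (simp only: assoc[OF game_homD(1)[OF f]] assoc[OF game_homD(2)[OF f]])
    assume g: "g \<in> game_hom b c"
    show "(compose (players a) (fst g) (fst f), compose (outcomes a) (snd g) (snd f)) \<in> game_hom a c"
    proof -
      have "compose (players a) (fst g) (fst f) \<in> players a \<rightarrow>\<^sub>E players c"
           "compose (outcomes a) (snd g) (snd f) \<in> outcomes a \<rightarrow>\<^sub>E outcomes c"
        using game_homD[OF f] game_homD[OF g]
        by (simp_all add: compose_def PiE_iff)
      moreover have
        "((x, y) \<in> accs a i \<longrightarrow> (snd g (snd f x), snd g (snd f y)) \<in> accs c (fst g (fst f i))) \<and>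
         ((x, y) \<in> pref a i \<longrightarrow> (snd g (snd f x), snd g (snd f y)) \<in> pref c (fst g (fst f i)))"
        if "i \<in> players a" "x \<in> outcomes a" "y \<in> outcomes a" for i x y
        using f g that PiE_mem[OF game_homD(1)[OF f]] PiE_mem[OF game_homD(2)[OF f]]
        unfolding game_hom_def case_prod_beta mem_Collect_eq by blast
      ultimately show ?thesis
        unfolding game_hom_def case_prod_beta mem_Collect_eq fst_conv snd_conv
        by (simp add: compose_eq)
    qed
  qed
qed

end

theory Submission
  imports Defs
begin

text \<open>
  The forgetful functor sending a game to its sets of players and outcomes is topological: every
  source of maps from a pair of sets into games has an initial lift, in which outcomes are related
  iff all their images are, and every sink has a final lift, in which the relations are generated by
  the images. Limits and colimits in \<open>Gam\<close> are therefore those of the two underlying sets, endowed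
  with the initial and the final structure.
\<close>

section \<open>Limits and colimits of small sets\<close>

text \<open>Hom-sets are extensional function spaces, as in \<open>game_hom\<close>: both components
  of a game morphism are morphisms here, and composition in \<open>Gam small\<close> is this
  composition in each component. Universal properties of sets can thus be applied to
  \<open>fst\<close> and \<open>snd\<close> separately.\<close>

definition Sets :: "'u set set \<Rightarrow> ('u set, 'u \<Rightarrow> 'u) category" where
  "Sets small =
     \<lparr>Obj = small, Hom = (\<lambda>A B. A \<rightarrow>\<^sub>E B), Ident = (\<lambda>A. restrict id A),
      Comp = (\<lambda>A B C g f. compose A g f)\<rparr>"

lemma Sets_simps [simp]:
  "Obj (Sets small) = small" "Hom (Sets small) A B = (A \<rightarrow>\<^sub>E B)"
  "Comp (Sets small) A B C g f = compose A g f"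
  by (simp_all add: Sets_def)

text \<open>Turns commuting triangles into pointwise equations. Off \<open>A\<close> the composite
  is \<open>undefined\<close>, and so is \<open>u\<close> by extensionality.\<close>

lemma compose_eq_iff:
  assumes "u \<in> extensional A"
  shows "compose A g f = u \<longleftrightarrow> (\<forall>x\<in>A. g (f x) = u x)"
proof
  assume "\<forall>x\<in>A. g (f x) = u x"
  with assms show "compose A g f = u"
    by (intro ext) (auto simp: compose_def extensional_def)
qed (auto simp: compose_def)

lemma compose_eq_compose_iff:
  "compose A g f = compose A g' f' \<longleftrightarrow> (\<forall>x\<in>A. g (f x) = g' (f' x))"
  by (auto simp: compose_def restrict_def fun_eq_iff)

context universe
begin

text \<open>The product is the dependent function space \<open>Pi\<^sub>E K F\<close>, whose
  elements are functions and not elements of \<open>'u\<close>. \<open>small_prod\<close> provides a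
  small set \<open>B\<close> of codes for them; the projections decode and evaluate at
  \<open>k\<close>.\<close>

lemma has_products_Sets:
  assumes "K \<in> idx"
  shows "has_products (Sets small) K"
  unfolding has_products_def
proof (intro allI impI)
  fix F assume "\<forall>k\<in>K. F k \<in> Obj (Sets small)"
  then obtain B \<phi> where B: "B \<in> small" and \<phi>: "bij_betw \<phi> B (Pi\<^sub>E K F)"
    using small_prod[OF assms, of F] unfolding Sets_simps eqpoll_def
    by (meson bij_betw_inv)
  define \<psi> where "\<psi> = inv_into B \<phi>"
  have \<phi>B: "\<phi> b \<in> Pi\<^sub>E K F" if "b \<in> B" for b
    using bij_betwE[OF \<phi>] that by blast
  have \<psi>: "\<psi> x \<in> B" "\<phi> (\<psi> x) = x" if "x \<in> Pi\<^sub>E K F" for x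
    using that \<phi> unfolding \<psi>_def
    by (metis bij_betw_imp_surj_on inv_into_into, metis bij_betw_inv_into_right)
  define p where "p k = restrict (\<lambda>b. \<phi> b k) B" for k
  have "is_product (Sets small) K F B p"
    unfolding is_product_def Sets_simps
  proof (intro conjI ballI allI impI)
    show "p k \<in> B \<rightarrow>\<^sub>E F k" if "k \<in> K" for k
      using \<phi>B that by (force simp: p_def)
    fix X u assume u: "\<forall>k\<in>K. u k \<in> X \<rightarrow>\<^sub>E F k"
    have comp: "(\<forall>k\<in>K. compose X (p k) h = u k) \<longleftrightarrow> (\<forall>k\<in>K. \<forall>x\<in>X. p k (h x) = u k x)" for h
      using u by (intro ball_cong refl compose_eq_iff) (auto simp: PiE_iff)
    \<comment> \<open>The mediating map sends \<open>x\<close> to the code of the tuple of all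
      \<open>u k x\<close>. The tuple is restricted to \<open>K\<close> because
      \<open>Pi\<^sub>E K F\<close> contains extensional functions only.\<close>
    define h where "h = restrict (\<lambda>x. \<psi> (restrict (\<lambda>k. u k x) K)) X"
    have ux: "restrict (\<lambda>k. u k x) K \<in> Pi\<^sub>E K F" if "x \<in> X" for x
      using u that by auto
    have h: "h x \<in> B" "\<phi> (h x) = restrict (\<lambda>k. u k x) K" if "x \<in> X" for x
      using \<psi>[OF ux[OF that]] that by (simp_all add: h_def)
    show "\<exists>!h. h \<in> X \<rightarrow>\<^sub>E B \<and> (\<forall>k\<in>K. compose X (p k) h = u k)"
    proof (rule ex1I[of _ h])
      have "h \<in> X \<rightarrow>\<^sub>E B" using h(1) by (simp add: PiE_iff) (simp add: h_def)
      then show "h \<in> X \<rightarrow>\<^sub>E B \<and> (\<forall>k\<in>K. compose X (p k) h = u k)"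
        unfolding comp by (simp add: p_def h)
      fix h' assume h': "h' \<in> X \<rightarrow>\<^sub>E B \<and> (\<forall>k\<in>K. compose X (p k) h' = u k)"
      show "h' = h"
      proof (rule extensionalityI[of _ X])
        fix x assume x: "x \<in> X"
        have h'x: "h' x \<in> B" using h' x by blast
        \<comment> \<open>Uniqueness: the projections fix every coordinate of the tuple coded by
          \<open>h' x\<close>, its coordinates in \<open>K\<close> fix the tuple, and
          \<open>\<phi>\<close> is injective on codes.\<close>
        have "p k (h' x) = u k x" if "k \<in> K" for k
          using h' that x unfolding comp by blast
        then have "\<phi> (h' x) k = u k x" if "k \<in> K" for k
          using that h'x by (simp add: p_def)
        then have "\<phi> (h' x) = \<phi> (h x)"
          using PiE_ext[OF \<phi>B[OF h'x] ux[OF x]] h(2)[OF x] by simp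
        then show "h' x = h x"
          using inj_onD[OF bij_betw_imp_inj_on[OF \<phi>]] h'x h(1)[OF x] by blast
      qed (use h' in \<open>simp_all add: h_def PiE_iff\<close>)
    qed
  qed (rule B)
  then show "\<exists>P \<pi>. is_product (Sets small) K F P \<pi>" by (intro exI)
qed

text \<open>The coproduct is the disjoint union \<open>Sigma K F\<close>, replaced by a small copy
  \<open>B\<close> over \<open>'u\<close> from \<open>small_sum\<close>; the injections are the
  tagged inclusions followed by the coding \<open>\<phi>\<close>.\<close>

lemma has_coproducts_Sets:
  assumes "K \<in> idx"
  shows "has_coproducts (Sets small) K"
  unfolding has_coproducts_def
proof (intro allI impI)
  fix F assume "\<forall>k\<in>K. F k \<in> Obj (Sets small)"
  then obtain B \<phi> where B: "B \<in> small" and \<phi>: "bij_betw \<phi> (Sigma K F) B"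
    using small_sum[OF assms, of F] unfolding Sets_simps eqpoll_def by blast
  define \<psi> where "\<psi> = inv_into (Sigma K F) \<phi>"
  have \<phi>B: "\<phi> (k, x) \<in> B" and \<psi>\<phi>: "\<psi> (\<phi> (k, x)) = (k, x)" if "k \<in> K" "x \<in> F k" for k x
    using bij_betwE[OF \<phi>] bij_betw_inv_into_left[OF \<phi>] that by (auto simp: \<psi>_def)
  \<comment> \<open>The injections are jointly surjective. This yields both that the mediating map
    has its values in \<open>X\<close> and that it is unique.\<close>
  have surj: "\<exists>k\<in>K. \<exists>x\<in>F k. b = \<phi> (k, x)" if "b \<in> B" for b
    using bij_betw_imp_surj_on[OF \<phi>] that by auto
  define q where "q k = restrict (\<lambda>x. \<phi> (k, x)) (F k)" for k
  have "is_coproduct (Sets small) K F B q"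
    unfolding is_coproduct_def Sets_simps
  proof (intro conjI ballI allI impI)
    show "q k \<in> F k \<rightarrow>\<^sub>E B" if "k \<in> K" for k
      using \<phi>B that by (auto simp: q_def)
    fix X u assume u: "\<forall>k\<in>K. u k \<in> F k \<rightarrow>\<^sub>E X"
    have comp: "(\<forall>k\<in>K. compose (F k) h (q k) = u k) \<longleftrightarrow>
        (\<forall>k\<in>K. \<forall>x\<in>F k. h (\<phi> (k, x)) = u k x)" for h
    proof (rule ball_cong[OF refl])
      fix k assume "k \<in> K"
      then have "u k \<in> extensional (F k)" using u by (auto simp: PiE_iff)
      then show "compose (F k) h (q k) = u k \<longleftrightarrow> (\<forall>x\<in>F k. h (\<phi> (k, x)) = u k x)"
        by (simp add: compose_eq_iff q_def)
    qed
    \<comment> \<open>Decoding \<open>b\<close> to a pair of an index and an element tells which map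
      of the cocone to apply, and where.\<close>
    define h where "h = restrict (\<lambda>b. u (fst (\<psi> b)) (snd (\<psi> b))) B"
    have h: "\<forall>k\<in>K. \<forall>x\<in>F k. h (\<phi> (k, x)) = u k x"
      by (simp add: h_def \<psi>\<phi> \<phi>B)
    show "\<exists>!h. h \<in> B \<rightarrow>\<^sub>E X \<and> (\<forall>k\<in>K. compose (F k) h (q k) = u k)"
      unfolding comp
    proof (rule ex1I[of _ h])
      have "h b \<in> X" if "b \<in> B" for b
        using surj[OF that] h u by fastforce
      moreover have "h \<in> extensional B" by (simp add: h_def)
      ultimately show "h \<in> B \<rightarrow>\<^sub>E X \<and> (\<forall>k\<in>K. \<forall>x\<in>F k. h (\<phi> (k, x)) = u k x)"
        using h by (simp add: PiE_iff)
      fix h' assume h': "h' \<in> B \<rightarrow>\<^sub>E X \<and> (\<forall>k\<in>K. \<forall>x\<in>F k. h' (\<phi> (k, x)) = u k x)"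
      show "h' = h"
      proof (rule extensionalityI[of _ B])
        show "h' b = h b" if "b \<in> B" for b
          using surj[OF that] h h' by auto
      qed (use h' in \<open>auto simp: h_def PiE_iff\<close>)
    qed
  qed (rule B)
  then show "\<exists>S \<iota>. is_coproduct (Sets small) K F S \<iota>" by (intro exI)
qed

lemma has_equalizers_Sets: "has_equalizers (Sets small)"
  unfolding has_equalizers_def Sets_simps
proof (intro ballI)
  fix A B :: "'u set" and f g assume A: "A \<in> small" and fg: "f \<in> A \<rightarrow>\<^sub>E B" "g \<in> A \<rightarrow>\<^sub>E B"
  define E where "E = {x \<in> A. f x = g x}"
  have "is_equalizer (Sets small) A B f g E (restrict id E)"
    unfolding is_equalizer_def Sets_simps
  proof (intro conjI ballI impI)
    show "E \<in> small" using small_subset[OF A] by (simp add: E_def)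
    show "restrict id E \<in> E \<rightarrow>\<^sub>E A" by (auto simp: E_def)
    show "compose E f (restrict id E) = compose E g (restrict id E)"
      by (auto simp: compose_eq_compose_iff E_def)
    fix X u assume u: "u \<in> X \<rightarrow>\<^sub>E A" "compose X f u = compose X g u"
    then have uE: "u \<in> X \<rightarrow>\<^sub>E E"
      by (auto simp: compose_eq_compose_iff E_def PiE_iff)
    have "u \<in> extensional X" using u(1) by (simp add: PiE_iff)
    \<comment> \<open>The equalizer map is an inclusion, so a factorization of \<open>u\<close>
      through it can only be \<open>u\<close> itself; existence and uniqueness both follow from this
      equivalence.\<close>
    then have "h \<in> X \<rightarrow>\<^sub>E E \<and> compose X (restrict id E) h = u \<longleftrightarrow> h = u" for h
      using uE by (auto simp: compose_eq_iff PiE_iff intro!: extensionalityI[of _ X])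
    then show "\<exists>!h. h \<in> X \<rightarrow>\<^sub>E E \<and> compose X (restrict id E) h = u" by simp
  qed
  then show "\<exists>E e. is_equalizer (Sets small) A B f g E e" by blast
qed

text \<open>The equivalence relation generated by \<open>f a \<sim> g a\<close> is obtained as the intersection of the kernels
  of all maps that coequalize \<open>f\<close> and \<open>g\<close>; the classes are represented by chosen elements.\<close>

lemma has_coequalizers_Sets: "has_coequalizers (Sets small)"
  unfolding has_coequalizers_def Sets_simps
proof (intro ballI)
  fix A B :: "'u set" and f g assume B: "B \<in> small" and fg: "f \<in> A \<rightarrow>\<^sub>E B" "g \<in> A \<rightarrow>\<^sub>E B"
  \<comment> \<open>All objects are sets over the one type \<open>'u\<close>, so every coequalizing
    map, whatever its codomain \<open>X\<close>, already occurs in this set of functions.\<close>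
  define U :: "('u \<Rightarrow> 'u) set" where "U = {u. \<forall>a\<in>A. u (f a) = u (g a)}"
  define r where "r x y \<longleftrightarrow> (\<forall>u\<in>U. u x = u y)" for x y
  define q where "q = restrict (\<lambda>x. SOME y. y \<in> B \<and> r x y) B"
  have q: "q x \<in> B \<and> r x (q x)" if "x \<in> B" for x
  proof -
    have "x \<in> B \<and> r x x" using that by (simp add: r_def)
    then have "(SOME y. y \<in> B \<and> r x y) \<in> B \<and> r x (SOME y. y \<in> B \<and> r x y)"
      by (rule someI)
    then show ?thesis using that by (simp add: q_def)
  qed
  have q_eq: "q x = q y" if "x \<in> B" "y \<in> B" "r x y" for x y
  proof -
    \<comment> \<open>Related elements have the same predicate \<open>r x\<close>, hence
      \<open>SOME\<close> picks the same representative for both.\<close>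
    have "r x = r y" using that(3) unfolding r_def by metis
    then show ?thesis using that by (simp add: q_def)
  qed
  have "is_coequalizer (Sets small) A B f g (q ` B) q"
    unfolding is_coequalizer_def Sets_simps
  proof (intro conjI ballI impI)
    \<comment> \<open>Representatives, unlike equivalence classes, are elements of
      \<open>'u\<close>; the quotient is therefore an image of \<open>B\<close>, to which the
      closure of \<open>small\<close> under images applies.\<close>
    show "q ` B \<in> small" by (rule small_image[OF B])
    show "q \<in> B \<rightarrow>\<^sub>E q ` B" by (auto simp: q_def)
    have "q (f a) = q (g a)" if "a \<in> A" for a
      using that fg by (intro q_eq) (auto simp: r_def U_def)
    then show "compose A q f = compose A q g" by (simp add: compose_eq_compose_iff)
    fix X and u :: "'u \<Rightarrow> 'u" assume u: "u \<in> B \<rightarrow>\<^sub>E X" "compose A u f = compose A u g"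
    have "u \<in> U" using u(2) by (simp add: compose_eq_compose_iff U_def)
    then have uq: "u (q x) = u x" if "x \<in> B" for x
      using q[OF that] unfolding r_def by metis
    have "u \<in> extensional B" using u(1) by (simp add: PiE_iff)
    note comp = compose_eq_iff[OF this]
    show "\<exists>!h. h \<in> q ` B \<rightarrow>\<^sub>E X \<and> compose B h q = u"
      unfolding comp
    \<comment> \<open>Representatives lie in \<open>B\<close>, and \<open>u\<close> agrees at
      \<open>x\<close> and \<open>q x\<close>, so the factorization is \<open>u\<close> cut down to
      the representatives.\<close>
    proof (rule ex1I[of _ "restrict u (q ` B)"])
      show "restrict u (q ` B) \<in> q ` B \<rightarrow>\<^sub>E X \<and> (\<forall>x\<in>B. restrict u (q ` B) (q x) = u x)"
        using u(1) uq by (auto simp: PiE_iff)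
      fix h assume "h \<in> q ` B \<rightarrow>\<^sub>E X \<and> (\<forall>x\<in>B. h (q x) = u x)"
      then show "h = restrict u (q ` B)"
        using uq by (intro extensionalityI[of _ "q ` B"]) (auto simp: PiE_iff)
    qed
  qed
  then show "\<exists>Q q. is_coequalizer (Sets small) A B f g Q q" by blast
qed

end


section \<open>Initial and final structures on games\<close>

lemma Gam_simps [simp]:
  "G \<in> Obj (Gam small) \<longleftrightarrow> is_game G \<and> players G \<in> small \<and> outcomes G \<in> small"
  "Hom (Gam small) = game_hom"
  "Comp (Gam small) G G' G'' g f =
     (compose (players G) (fst g) (fst f), compose (outcomes G) (snd g) (snd f))"
  by (simp_all add: Gam_def)

lemma game_hom_iff:
  "f \<in> game_hom G G' \<longleftrightarrow>
     fst f \<in> players G \<rightarrow>\<^sub>E players G' \<and> snd f \<in> outcomes G \<rightarrow>\<^sub>E outcomes G' \<and>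
     (\<forall>i\<in>players G. \<forall>x\<in>outcomes G. \<forall>y\<in>outcomes G.
        ((x, y) \<in> accs G i \<longrightarrow> (snd f x, snd f y) \<in> accs G' (fst f i)) \<and>
        ((x, y) \<in> pref G i \<longrightarrow> (snd f x, snd f y) \<in> pref G' (fst f i)))"
  by (cases f) (simp add: game_hom_def)

lemma is_gameD:
  assumes "is_game G" "i \<in> players G"
  shows "(x, y) \<in> accs G i \<Longrightarrow> x \<in> outcomes G \<and> y \<in> outcomes G"
    and "x \<in> outcomes G \<Longrightarrow> (x, x) \<in> accs G i"
    and "(x, y) \<in> accs G i \<Longrightarrow> (y, x) \<in> accs G i"
    and "(x, y) \<in> pref G i \<Longrightarrow> x \<in> outcomes G \<and> y \<in> outcomes G"
    and "x \<in> outcomes G \<Longrightarrow> (x, x) \<in> pref G i"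
    and "trans (pref G i)"
  using assms unfolding is_game_def preorder_on_def
  by (auto dest: refl_onD symD)

section \<open>Initial structures: games induced by families of maps into games\<close>

definition initial_game ::
  "'k set \<Rightarrow> ('k \<Rightarrow> 'u game) \<Rightarrow> 'u set \<Rightarrow> 'u set \<Rightarrow> ('k \<Rightarrow> ('u \<Rightarrow> 'u) \<times> ('u \<Rightarrow> 'u)) \<Rightarrow> 'u game" where
  "initial_game K G I O' \<pi> =
     \<lparr>players = I, outcomes = O',
      accs = (\<lambda>i. {(x, y). i \<in> I \<and> x \<in> O' \<and> y \<in> O' \<and>
        (\<forall>k\<in>K. (snd (\<pi> k) x, snd (\<pi> k) y) \<in> accs (G k) (fst (\<pi> k) i))}),
      pref = (\<lambda>i. {(x, y). i \<in> I \<and> x \<in> O' \<and> y \<in> O' \<and>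
        (\<forall>k\<in>K. (snd (\<pi> k) x, snd (\<pi> k) y) \<in> pref (G k) (fst (\<pi> k) i))})\<rparr>"

lemma initial_game_simps [simp]:
  "players (initial_game K G I O' \<pi>) = I" "outcomes (initial_game K G I O' \<pi>) = O'"
  by (simp_all add: initial_game_def)

text \<open>Reflexivity, symmetry and transitivity pass to preimages along the maps
  \<open>snd (\<pi> k)\<close> and to intersections over \<open>K\<close>. The guards
  \<open>i \<in> I\<close>, \<open>x \<in> O'\<close> and \<open>y \<in> O'\<close> confine the
  relations as \<open>is_game\<close> demands; for empty \<open>K\<close> only they remain, and each
  player in \<open>I\<close> then relates any two outcomes.\<close>

lemma is_game_initial_game:
  assumes "\<And>k. k \<in> K \<Longrightarrow> is_game (G k)"
    and "\<And>k. k \<in> K \<Longrightarrow> fst (\<pi> k) \<in> I \<rightarrow>\<^sub>E players (G k)"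
    and "\<And>k. k \<in> K \<Longrightarrow> snd (\<pi> k) \<in> O' \<rightarrow>\<^sub>E outcomes (G k)"
  shows "is_game (initial_game K G I O' \<pi>)"
proof -
  have 1: "fst (\<pi> k) i \<in> players (G k)" if "k \<in> K" "i \<in> I" for k i
    using assms(2) that by blast
  have 2: "snd (\<pi> k) x \<in> outcomes (G k)" if "k \<in> K" "x \<in> O'" for k x
    using assms(3) that by blast
  note D = is_gameD[OF assms(1) 1]
  have tr: "(snd (\<pi> k) x, snd (\<pi> k) z) \<in> pref (G k) (fst (\<pi> k) i)"
    if "k \<in> K" "i \<in> I" "(snd (\<pi> k) x, snd (\<pi> k) y) \<in> pref (G k) (fst (\<pi> k) i)"
      "(snd (\<pi> k) y, snd (\<pi> k) z) \<in> pref (G k) (fst (\<pi> k) i)" for k i x y z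
    using transD[OF D(6)] that by blast
  let ?G = "initial_game K G I O' \<pi>"
  have "accs ?G i \<subseteq> O' \<times> O'" "pref ?G i \<subseteq> O' \<times> O'" for i
    by (auto simp: initial_game_def)
  moreover have "refl_on O' (accs ?G i)" "refl_on O' (pref ?G i)" if "i \<in> I" for i
    using that D(2,5) 2 by (auto simp: initial_game_def intro!: refl_onI)
  moreover have "sym (accs ?G i)" for i
    using D(3) by (auto simp: initial_game_def intro!: symI)
  moreover have "trans (pref ?G i)" for i
    using tr unfolding initial_game_def game.simps by (intro transI) blast
  moreover have "accs ?G i = {}" "pref ?G i = {}" if "i \<notin> I" for i
    using that by (auto simp: initial_game_def)
  ultimately show ?thesis
    by (simp add: is_game_def preorder_on_def)
qed

lemma initial_game_projection:
  assumes "k \<in> K" "fst (\<pi> k) \<in> I \<rightarrow>\<^sub>E players (G k)" "snd (\<pi> k) \<in> O' \<rightarrow>\<^sub>E outcomes (G k)"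
  shows "\<pi> k \<in> game_hom (initial_game K G I O' \<pi>) (G k)"
  using assms unfolding game_hom_iff initial_game_def game.simps by blast

text \<open>Initiality: whether \<open>h\<close> preserves a relation is tested after composing with
  each \<open>\<pi> k\<close>, and the composite is the morphism \<open>f k\<close>.\<close>

lemma game_hom_initial_game:
  assumes "fst h \<in> players X \<rightarrow>\<^sub>E I" "snd h \<in> outcomes X \<rightarrow>\<^sub>E O'"
    and "\<And>k. k \<in> K \<Longrightarrow> f k \<in> game_hom X (G k)"
    and "\<And>k. k \<in> K \<Longrightarrow> compose (players X) (fst (\<pi> k)) (fst h) = fst (f k)"
    and "\<And>k. k \<in> K \<Longrightarrow> compose (outcomes X) (snd (\<pi> k)) (snd h) = snd (f k)"
  shows "h \<in> game_hom X (initial_game K G I O' \<pi>)"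
proof -
  have 1: "fst (\<pi> k) (fst h i) = fst (f k) i" if "k \<in> K" "i \<in> players X" for k i
    using assms(4)[OF that(1)] that(2) by (metis compose_eq)
  have 2: "snd (\<pi> k) (snd h x) = snd (f k) x" if "k \<in> K" "x \<in> outcomes X" for k x
    using assms(5)[OF that(1)] that(2) by (metis compose_eq)
  show ?thesis
    using assms(1-3) by (auto simp: game_hom_iff initial_game_def 1 2)
qed

section \<open>Final structures: games induced by families of maps out of games\<close>

definition final_rel ::
  "'k set \<Rightarrow> ('k \<Rightarrow> 'u game) \<Rightarrow> ('u game \<Rightarrow> 'u \<Rightarrow> 'u rel) \<Rightarrow> 'u set \<Rightarrow>
    ('k \<Rightarrow> ('u \<Rightarrow> 'u) \<times> ('u \<Rightarrow> 'u)) \<Rightarrow> 'u \<Rightarrow> 'u rel" where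
  "final_rel K G R O' \<iota> i =
     Id_on O' \<union> {(snd (\<iota> k) x, snd (\<iota> k) y) |k j x y.
       k \<in> K \<and> j \<in> players (G k) \<and> fst (\<iota> k) j = i \<and> (x, y) \<in> R (G k) j}"

text \<open>In \<open>final_rel\<close>, \<open>Id_on O'\<close> supplies the reflexive pairs that
  no map of the sink provides for player \<open>i\<close>, for instance, in a coproduct, those at
  outcomes of the other games. Images of symmetric relations are symmetric, but images of transitive
  ones may fail to be transitive, hence the closure for preferences. It is \<open>\<^sup>+\<close>,
  as the reflexive transitive closure would relate elements outside \<open>O'\<close>.\<close>

definition final_game ::
  "'k set \<Rightarrow> ('k \<Rightarrow> 'u game) \<Rightarrow> 'u set \<Rightarrow> 'u set \<Rightarrow> ('k \<Rightarrow> ('u \<Rightarrow> 'u) \<times> ('u \<Rightarrow> 'u)) \<Rightarrow> 'u game" where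
  "final_game K G I O' \<iota> =
     \<lparr>players = I, outcomes = O',
      accs = (\<lambda>i. if i \<in> I then final_rel K G accs O' \<iota> i else {}),
      pref = (\<lambda>i. if i \<in> I then (final_rel K G pref O' \<iota> i)\<^sup>+ else {})\<rparr>"

lemma final_game_simps [simp]:
  "players (final_game K G I O' \<iota>) = I" "outcomes (final_game K G I O' \<iota>) = O'"
  by (simp_all add: final_game_def)

lemma is_game_final_game:
  assumes "\<And>k. k \<in> K \<Longrightarrow> is_game (G k)"
    and "\<And>k. k \<in> K \<Longrightarrow> snd (\<iota> k) \<in> outcomes (G k) \<rightarrow>\<^sub>E O'"
  shows "is_game (final_game K G I O' \<iota>)"
proof -
  note D = is_gameD[OF assms(1)]
  have 2: "snd (\<iota> k) x \<in> O'" if "k \<in> K" "x \<in> outcomes (G k)" for k x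
    using assms(2) that by blast
  have a: "final_rel K G accs O' \<iota> i \<subseteq> O' \<times> O'" for i
    unfolding final_rel_def using D(1) 2 by blast
  have p: "final_rel K G pref O' \<iota> i \<subseteq> O' \<times> O'" for i
    unfolding final_rel_def using D(4) 2 by blast
  have r: "(x, x) \<in> final_rel K G R O' \<iota> i" if "x \<in> O'" for x i R
    using that by (auto simp: final_rel_def)
  have s: "sym (final_rel K G accs O' \<iota> i)" for i
    unfolding final_rel_def using D(3) by (intro symI) blast
  show ?thesis
    unfolding is_game_def preorder_on_def final_game_def game.simps
    using a s r trancl_subset_Sigma[OF p]
    by (auto intro!: refl_onI intro: r_into_trancl)
qed

lemma final_game_injection:
  assumes "k \<in> K" "fst (\<iota> k) \<in> players (G k) \<rightarrow>\<^sub>E I" "snd (\<iota> k) \<in> outcomes (G k) \<rightarrow>\<^sub>E O'"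
  shows "\<iota> k \<in> game_hom (G k) (final_game K G I O' \<iota>)"
proof -
  have "(snd (\<iota> k) x, snd (\<iota> k) y) \<in> final_rel K G R O' \<iota> (fst (\<iota> k) i)"
    if "i \<in> players (G k)" "(x, y) \<in> R (G k) i" for i x y R
    using assms(1) that unfolding final_rel_def by blast
  then show ?thesis
    using assms(2,3) by (auto simp: game_hom_iff final_game_def intro!: r_into_trancl)
qed

text \<open>Finality: only generating pairs have to be checked. Diagonal pairs are preserved because
  the relations of \<open>X\<close> are reflexive, image pairs because \<open>h\<close> after
  \<open>\<iota> k\<close> is the morphism \<open>f k\<close>, and the transitive closure because
  preferences of \<open>X\<close> are transitive.\<close>

lemma game_hom_final_game:
  assumes X: "is_game X"
    and G: "\<And>k. k \<in> K \<Longrightarrow> is_game (G k)"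
    and h: "fst h \<in> I \<rightarrow>\<^sub>E players X" "snd h \<in> O' \<rightarrow>\<^sub>E outcomes X"
    and f: "\<And>k. k \<in> K \<Longrightarrow> f k \<in> game_hom (G k) X"
    and comp: "\<And>k. k \<in> K \<Longrightarrow> compose (players (G k)) (fst h) (fst (\<iota> k)) = fst (f k)"
      "\<And>k. k \<in> K \<Longrightarrow> compose (outcomes (G k)) (snd h) (snd (\<iota> k)) = snd (f k)"
  shows "h \<in> game_hom (final_game K G I O' \<iota>) X"
proof -
  have 1: "fst h (fst (\<iota> k) i) = fst (f k) i" if "k \<in> K" "i \<in> players (G k)" for k i
    using comp(1)[OF that(1)] that(2) by (metis compose_eq)
  have 2: "snd h (snd (\<iota> k) x) = snd (f k) x" if "k \<in> K" "x \<in> outcomes (G k)" for k x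
    using comp(2)[OF that(1)] that(2) by (metis compose_eq)
  have hX: "fst h i \<in> players X" if "i \<in> I" for i
    using h(1) that by blast
  have hO: "snd h x \<in> outcomes X" if "x \<in> O'" for x
    using h(2) that by blast
  \<comment> \<open>Accessibility and preference share the argument for generators, so it is carried
    out once, with \<open>R\<close> ranging over the two field selectors.\<close>
  have gen: "(snd h x, snd h y) \<in> R X (fst h i)"
    if xy: "(x, y) \<in> final_rel K G R O' \<iota> i" and i: "i \<in> I" and R: "R = accs \<or> R = pref" for R i x y
    using xy unfolding final_rel_def
  proof
    assume "(x, y) \<in> Id_on O'"
    then show ?thesis
      using R is_gameD(2,5)[OF X hX[OF i] hO] by auto
  next
    assume "(x, y) \<in> {(snd (\<iota> k) x, snd (\<iota> k) y) |k j x y.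
      k \<in> K \<and> j \<in> players (G k) \<and> fst (\<iota> k) j = i \<and> (x, y) \<in> R (G k) j}"
    then obtain k j a b where kj: "k \<in> K" "j \<in> players (G k)" "fst (\<iota> k) j = i" "(a, b) \<in> R (G k) j"
      and xy: "x = snd (\<iota> k) a" "y = snd (\<iota> k) b" by blast
    \<comment> \<open>A morphism is constrained only on pairs of outcomes. That \<open>G k\<close>
      is a game places \<open>a\<close> and \<open>b\<close> among them.\<close>
    have ab: "a \<in> outcomes (G k)" "b \<in> outcomes (G k)"
      using R is_gameD(1,4)[OF G[OF kj(1)] kj(2)] kj(4) by auto
    have "(snd (f k) a, snd (f k) b) \<in> R X (fst (f k) j)"
      using f[OF kj(1)] kj(2,4) ab R by (auto simp: game_hom_iff)
    then show ?thesis
      using 1[OF kj(1,2)] 2[OF kj(1)] ab by (simp add: kj(3) xy)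
  qed
  have pref: "(snd h x, snd h y) \<in> pref X (fst h i)"
    if "(x, y) \<in> (final_rel K G pref O' \<iota> i)\<^sup>+" and i: "i \<in> I" for i x y
    using that(1)
  proof (induction rule: trancl_induct)
    case (step y z)
    then show ?case
      using gen[OF step(2) i] transD[OF is_gameD(6)[OF X hX[OF i]]] by blast
  qed (use gen i in blast)
  show ?thesis
    using h gen pref by (auto simp: game_hom_iff final_game_def)
qed


section \<open>Lifting limits and colimits to games\<close>

lemma is_product_universal:
  assumes "is_product C K G P \<pi>" "X \<in> Obj C" "\<And>k. k \<in> K \<Longrightarrow> f k \<in> Hom C X (G k)"
  shows "\<exists>!h. h \<in> Hom C X P \<and> (\<forall>k\<in>K. Comp C X P (G k) (\<pi> k) h = f k)"
  using assms unfolding is_product_def by blast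

lemma is_coproduct_universal:
  assumes "is_coproduct C K G S \<iota>" "X \<in> Obj C" "\<And>k. k \<in> K \<Longrightarrow> f k \<in> Hom C (G k) X"
  shows "\<exists>!h. h \<in> Hom C S X \<and> (\<forall>k\<in>K. Comp C (G k) S X h (\<iota> k) = f k)"
  using assms unfolding is_coproduct_def by blast

lemma is_equalizer_universal:
  assumes "is_equalizer C a b f g E e" "X \<in> Obj C" "u \<in> Hom C X a"
    and "Comp C X a b f u = Comp C X a b g u"
  shows "\<exists>!h. h \<in> Hom C X E \<and> Comp C X E a e h = u"
  using assms unfolding is_equalizer_def by blast

lemma is_coequalizer_universal:
  assumes "is_coequalizer C a b f g Q q" "X \<in> Obj C" "u \<in> Hom C b X"
    and "Comp C a b X u f = Comp C a b X u g"
  shows "\<exists>!h. h \<in> Hom C Q X \<and> Comp C b Q X h q = u"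
  using assms unfolding is_coequalizer_def by blast

text \<open>The universal properties in sets give unique mediating maps \<open>hp\<close> on players
  and \<open>ho\<close> on outcomes; initiality makes the pair \<open>(hp, ho)\<close> a morphism.
  It is unique because the components of any competitor are mediating maps of sets. The three lemmas
  that follow have the same shape.\<close>

lemma is_product_Gam:
  assumes G: "\<And>k. k \<in> K \<Longrightarrow> G k \<in> Obj (Gam small)"
    and p: "is_product (Sets small) K (\<lambda>k. players (G k)) I \<pi>"
    and o: "is_product (Sets small) K (\<lambda>k. outcomes (G k)) O' \<rho>"
  shows "is_product (Gam small) K G (initial_game K G I O' (\<lambda>k. (\<pi> k, \<rho> k))) (\<lambda>k. (\<pi> k, \<rho> k))"
    (is "is_product _ _ _ ?P ?\<pi>")
  unfolding is_product_def
proof (intro conjI ballI allI impI)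
  have \<pi>: "\<pi> k \<in> I \<rightarrow>\<^sub>E players (G k)" and \<rho>: "\<rho> k \<in> O' \<rightarrow>\<^sub>E outcomes (G k)" if "k \<in> K" for k
    using p o that by (auto simp: is_product_def)
  show "?P \<in> Obj (Gam small)"
    using is_game_initial_game[of K G ?\<pi> I O'] p o G \<pi> \<rho> by (simp add: is_product_def)
  show "?\<pi> k \<in> Hom (Gam small) ?P (G k)" if "k \<in> K" for k
    using initial_game_projection[of k K ?\<pi>] that \<pi> \<rho> by simp
  fix X f assume X: "X \<in> Obj (Gam small)" and f: "\<forall>k\<in>K. f k \<in> Hom (Gam small) X (G k)"
  have "\<exists>!h. h \<in> players X \<rightarrow>\<^sub>E I \<and> (\<forall>k\<in>K. compose (players X) (\<pi> k) h = fst (f k))"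
    using is_product_universal[OF p, of "players X" "\<lambda>k. fst (f k)"] X f
    by (simp add: game_homD)
  then obtain hp where hp: "hp \<in> players X \<rightarrow>\<^sub>E I" "\<forall>k\<in>K. compose (players X) (\<pi> k) hp = fst (f k)"
    and hp_unique: "\<And>h. h \<in> players X \<rightarrow>\<^sub>E I \<Longrightarrow> \<forall>k\<in>K. compose (players X) (\<pi> k) h = fst (f k) \<Longrightarrow> h = hp"
    by metis
  have "\<exists>!h. h \<in> outcomes X \<rightarrow>\<^sub>E O' \<and> (\<forall>k\<in>K. compose (outcomes X) (\<rho> k) h = snd (f k))"
    using is_product_universal[OF o, of "outcomes X" "\<lambda>k. snd (f k)"] X f
    by (simp add: game_homD)
  then obtain ho where ho: "ho \<in> outcomes X \<rightarrow>\<^sub>E O'" "\<forall>k\<in>K. compose (outcomes X) (\<rho> k) ho = snd (f k)"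
    and ho_unique: "\<And>h. h \<in> outcomes X \<rightarrow>\<^sub>E O' \<Longrightarrow> \<forall>k\<in>K. compose (outcomes X) (\<rho> k) h = snd (f k) \<Longrightarrow> h = ho"
    by metis
  show "\<exists>!h. h \<in> Hom (Gam small) X ?P \<and> (\<forall>k\<in>K. Comp (Gam small) X ?P (G k) (?\<pi> k) h = f k)"
  proof (rule ex1I[of _ "(hp, ho)"])
    show "(hp, ho) \<in> Hom (Gam small) X ?P \<and> (\<forall>k\<in>K. Comp (Gam small) X ?P (G k) (?\<pi> k) (hp, ho) = f k)"
      using game_hom_initial_game[of "(hp, ho)" X I O' K f G ?\<pi>] hp ho f by simp
    fix h assume "h \<in> Hom (Gam small) X ?P \<and> (\<forall>k\<in>K. Comp (Gam small) X ?P (G k) (?\<pi> k) h = f k)"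
    then show "h = (hp, ho)"
      using hp_unique[of "fst h"] ho_unique[of "snd h"] game_homD[of h X ?P] by (simp add: prod_eq_iff)
  qed
qed

text \<open>Dual to products: the mediating maps now leave the coproduct sets, and finality makes
  their pair a morphism.\<close>

lemma is_coproduct_Gam:
  assumes G: "\<And>k. k \<in> K \<Longrightarrow> G k \<in> Obj (Gam small)"
    and p: "is_coproduct (Sets small) K (\<lambda>k. players (G k)) I \<pi>"
    and o: "is_coproduct (Sets small) K (\<lambda>k. outcomes (G k)) O' \<rho>"
  shows "is_coproduct (Gam small) K G (final_game K G I O' (\<lambda>k. (\<pi> k, \<rho> k))) (\<lambda>k. (\<pi> k, \<rho> k))"
    (is "is_coproduct _ _ _ ?S ?\<iota>")
  unfolding is_coproduct_def
proof (intro conjI ballI allI impI)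
  have \<pi>: "\<pi> k \<in> players (G k) \<rightarrow>\<^sub>E I" and \<rho>: "\<rho> k \<in> outcomes (G k) \<rightarrow>\<^sub>E O'" if "k \<in> K" for k
    using p o that by (auto simp: is_coproduct_def)
  show "?S \<in> Obj (Gam small)"
    using is_game_final_game[of K G ?\<iota> O' I] p o G \<rho> by (simp add: is_coproduct_def)
  show "?\<iota> k \<in> Hom (Gam small) (G k) ?S" if "k \<in> K" for k
    using final_game_injection[of k K ?\<iota>] that \<pi> \<rho> by simp
  fix X f assume X: "X \<in> Obj (Gam small)" and f: "\<forall>k\<in>K. f k \<in> Hom (Gam small) (G k) X"
  have "\<exists>!h. h \<in> I \<rightarrow>\<^sub>E players X \<and> (\<forall>k\<in>K. compose (players (G k)) h (\<pi> k) = fst (f k))"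
    using is_coproduct_universal[OF p, of "players X" "\<lambda>k. fst (f k)"] X f
    by (simp add: game_homD)
  then obtain hp where hp: "hp \<in> I \<rightarrow>\<^sub>E players X" "\<forall>k\<in>K. compose (players (G k)) hp (\<pi> k) = fst (f k)"
    and hp_unique: "\<And>h. h \<in> I \<rightarrow>\<^sub>E players X \<Longrightarrow>
      \<forall>k\<in>K. compose (players (G k)) h (\<pi> k) = fst (f k) \<Longrightarrow> h = hp"
    by metis
  have "\<exists>!h. h \<in> O' \<rightarrow>\<^sub>E outcomes X \<and> (\<forall>k\<in>K. compose (outcomes (G k)) h (\<rho> k) = snd (f k))"
    using is_coproduct_universal[OF o, of "outcomes X" "\<lambda>k. snd (f k)"] X f
    by (simp add: game_homD)
  then obtain ho where ho: "ho \<in> O' \<rightarrow>\<^sub>E outcomes X" "\<forall>k\<in>K. compose (outcomes (G k)) ho (\<rho> k) = snd (f k)"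
    and ho_unique: "\<And>h. h \<in> O' \<rightarrow>\<^sub>E outcomes X \<Longrightarrow>
      \<forall>k\<in>K. compose (outcomes (G k)) h (\<rho> k) = snd (f k) \<Longrightarrow> h = ho"
    by metis
  show "\<exists>!h. h \<in> Hom (Gam small) ?S X \<and> (\<forall>k\<in>K. Comp (Gam small) (G k) ?S X h (?\<iota> k) = f k)"
  proof (rule ex1I[of _ "(hp, ho)"])
    show "(hp, ho) \<in> Hom (Gam small) ?S X \<and> (\<forall>k\<in>K. Comp (Gam small) (G k) ?S X (hp, ho) (?\<iota> k) = f k)"
      using game_hom_final_game[of X K G "(hp, ho)" I O' f ?\<iota>] hp ho f X G by simp
    fix h assume "h \<in> Hom (Gam small) ?S X \<and> (\<forall>k\<in>K. Comp (Gam small) (G k) ?S X h (?\<iota> k) = f k)"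
    then show "h = (hp, ho)"
      using hp_unique[of "fst h"] ho_unique[of "snd h"] game_homD[of h ?S X] by (simp add: prod_eq_iff)
  qed
qed

text \<open>The structure is initial for the single map \<open>(\<pi>, \<rho>)\<close> into
  \<open>a\<close>, viewed as a family over the one-element index set \<open>{()}\<close>. The fork
  equation and uniqueness are checked in the two components.\<close>

lemma is_equalizer_Gam:
  assumes a: "a \<in> Obj (Gam small)"
    and p: "is_equalizer (Sets small) (players a) (players b) (fst f) (fst g) I \<pi>"
    and o: "is_equalizer (Sets small) (outcomes a) (outcomes b) (snd f) (snd g) O' \<rho>"
  shows "is_equalizer (Gam small) a b f g
    (initial_game {()} (\<lambda>_. a) I O' (\<lambda>_. (\<pi>, \<rho>))) (\<pi>, \<rho>)"
    (is "is_equalizer _ _ _ _ _ ?E ?e")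
  unfolding is_equalizer_def
proof (intro conjI ballI impI)
  have \<pi>: "\<pi> \<in> I \<rightarrow>\<^sub>E players a" and \<rho>: "\<rho> \<in> O' \<rightarrow>\<^sub>E outcomes a"
    using p o by (auto simp: is_equalizer_def)
  show "?E \<in> Obj (Gam small)"
    using is_game_initial_game[of "{()}" "\<lambda>_. a" "\<lambda>_. ?e" I O'] p o a \<pi> \<rho>
    by (simp add: is_equalizer_def)
  show "?e \<in> Hom (Gam small) ?E a"
    using initial_game_projection[of "()" "{()}" "\<lambda>_. ?e" _ "\<lambda>_. a"] \<pi> \<rho> by simp
  show "Comp (Gam small) ?E a b f ?e = Comp (Gam small) ?E a b g ?e"
    using p o by (simp add: is_equalizer_def)
  fix X u assume X: "X \<in> Obj (Gam small)" and u: "u \<in> Hom (Gam small) X a"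
    and eq: "Comp (Gam small) X a b f u = Comp (Gam small) X a b g u"
  have "\<exists>!h. h \<in> players X \<rightarrow>\<^sub>E I \<and> compose (players X) \<pi> h = fst u"
    using is_equalizer_universal[OF p, of "players X" "fst u"] X u eq
    by (simp add: game_homD)
  then obtain hp where hp: "hp \<in> players X \<rightarrow>\<^sub>E I" "compose (players X) \<pi> hp = fst u"
    and hp_unique: "\<And>h. h \<in> players X \<rightarrow>\<^sub>E I \<Longrightarrow> compose (players X) \<pi> h = fst u \<Longrightarrow> h = hp"
    by metis
  have "\<exists>!h. h \<in> outcomes X \<rightarrow>\<^sub>E O' \<and> compose (outcomes X) \<rho> h = snd u"
    using is_equalizer_universal[OF o, of "outcomes X" "snd u"] X u eq
    by (simp add: game_homD)
  then obtain ho where ho: "ho \<in> outcomes X \<rightarrow>\<^sub>E O'" "compose (outcomes X) \<rho> ho = snd u"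
    and ho_unique: "\<And>h. h \<in> outcomes X \<rightarrow>\<^sub>E O' \<Longrightarrow> compose (outcomes X) \<rho> h = snd u \<Longrightarrow> h = ho"
    by metis
  show "\<exists>!h. h \<in> Hom (Gam small) X ?E \<and> Comp (Gam small) X ?E a ?e h = u"
  proof (rule ex1I[of _ "(hp, ho)"])
    show "(hp, ho) \<in> Hom (Gam small) X ?E \<and> Comp (Gam small) X ?E a ?e (hp, ho) = u"
      using game_hom_initial_game[of "(hp, ho)" X I O' "{()}" "\<lambda>_. u" "\<lambda>_. a" "\<lambda>_. ?e"] hp ho u by simp
    fix h assume "h \<in> Hom (Gam small) X ?E \<and> Comp (Gam small) X ?E a ?e h = u"
    then show "h = (hp, ho)"
      using hp_unique[of "fst h"] ho_unique[of "snd h"] game_homD[of h X ?E] by (simp add: prod_eq_iff)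
  qed
qed

text \<open>The structure is final for the single map \<open>(\<pi>, \<rho>)\<close> out of
  \<open>b\<close>. Identifying outcomes can join preference pairs into new chains, and identifying
  players merges their preferences; the transitive closure in \<open>final_game\<close> restores a
  preorder.\<close>

lemma is_coequalizer_Gam:
  assumes b: "b \<in> Obj (Gam small)"
    and p: "is_coequalizer (Sets small) (players a) (players b) (fst f) (fst g) I \<pi>"
    and o: "is_coequalizer (Sets small) (outcomes a) (outcomes b) (snd f) (snd g) O' \<rho>"
  shows "is_coequalizer (Gam small) a b f g
    (final_game {()} (\<lambda>_. b) I O' (\<lambda>_. (\<pi>, \<rho>))) (\<pi>, \<rho>)"
    (is "is_coequalizer _ _ _ _ _ ?Q ?q")
  unfolding is_coequalizer_def
proof (intro conjI ballI impI)
  have \<pi>: "\<pi> \<in> players b \<rightarrow>\<^sub>E I" and \<rho>: "\<rho> \<in> outcomes b \<rightarrow>\<^sub>E O'"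
    using p o by (auto simp: is_coequalizer_def)
  show "?Q \<in> Obj (Gam small)"
    using is_game_final_game[of "{()}" "\<lambda>_. b" "\<lambda>_. ?q" O' I] p o b \<rho>
    by (simp add: is_coequalizer_def)
  show "?q \<in> Hom (Gam small) b ?Q"
    using final_game_injection[of "()" "{()}" "\<lambda>_. ?q" "\<lambda>_. b"] \<pi> \<rho> by simp
  show "Comp (Gam small) a b ?Q ?q f = Comp (Gam small) a b ?Q ?q g"
    using p o by (simp add: is_coequalizer_def)
  fix X u assume X: "X \<in> Obj (Gam small)" and u: "u \<in> Hom (Gam small) b X"
    and eq: "Comp (Gam small) a b X u f = Comp (Gam small) a b X u g"
  have "\<exists>!h. h \<in> I \<rightarrow>\<^sub>E players X \<and> compose (players b) h \<pi> = fst u"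
    using is_coequalizer_universal[OF p, of "players X" "fst u"] X u eq
    by (simp add: game_homD)
  then obtain hp where hp: "hp \<in> I \<rightarrow>\<^sub>E players X" "compose (players b) hp \<pi> = fst u"
    and hp_unique: "\<And>h. h \<in> I \<rightarrow>\<^sub>E players X \<Longrightarrow> compose (players b) h \<pi> = fst u \<Longrightarrow> h = hp"
    by metis
  have "\<exists>!h. h \<in> O' \<rightarrow>\<^sub>E outcomes X \<and> compose (outcomes b) h \<rho> = snd u"
    using is_coequalizer_universal[OF o, of "outcomes X" "snd u"] X u eq
    by (simp add: game_homD)
  then obtain ho where ho: "ho \<in> O' \<rightarrow>\<^sub>E outcomes X" "compose (outcomes b) ho \<rho> = snd u"
    and ho_unique: "\<And>h. h \<in> O' \<rightarrow>\<^sub>E outcomes X \<Longrightarrow> compose (outcomes b) h \<rho> = snd u \<Longrightarrow> h = ho"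
    by metis
  show "\<exists>!h. h \<in> Hom (Gam small) ?Q X \<and> Comp (Gam small) b ?Q X h ?q = u"
  proof (rule ex1I[of _ "(hp, ho)"])
    show "(hp, ho) \<in> Hom (Gam small) ?Q X \<and> Comp (Gam small) b ?Q X (hp, ho) ?q = u"
      using game_hom_final_game[of X "{()}" "\<lambda>_. b" "(hp, ho)" I O' "\<lambda>_. u" "\<lambda>_. ?q"] hp ho u X b
      by simp
    fix h assume "h \<in> Hom (Gam small) ?Q X \<and> Comp (Gam small) b ?Q X h ?q = u"
    then show "h = (hp, ho)"
      using hp_unique[of "fst h"] ho_unique[of "snd h"] game_homD[of h ?Q X] by (simp add: prod_eq_iff)
  qed
qed

theorem theorem3p12:
  fixes small :: "'u set set" and idx :: "'k set set"
  assumes "universe small idx"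
  shows "complete_category idx (Gam small) \<and> cocomplete_category idx (Gam small)"
proof -
  interpret universe small idx by (rule assms)
  \<comment> \<open>Objects of \<open>Gam small\<close> have small sets of players and of outcomes,
    so the diagrams underlying a diagram of games lie in \<open>Sets small\<close>. Their limits and
    colimits are taken there separately and then lifted; the other three cases proceed
    alike.\<close>
  have "has_products (Gam small) K" if "K \<in> idx" for K
    unfolding has_products_def
  proof (intro allI impI)
    fix G assume G: "\<forall>k\<in>K. G k \<in> Obj (Gam small)"
    then have "\<exists>I \<pi>. is_product (Sets small) K (\<lambda>k. players (G k)) I \<pi>"
      "\<exists>O' \<rho>. is_product (Sets small) K (\<lambda>k. outcomes (G k)) O' \<rho>"
      using has_products_Sets[OF that] by (auto simp: has_products_def)
    then show "\<exists>P \<pi>. is_product (Gam small) K G P \<pi>"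
      using is_product_Gam[of K G] G by blast
  qed
  moreover have "has_coproducts (Gam small) K" if "K \<in> idx" for K
    unfolding has_coproducts_def
  proof (intro allI impI)
    fix G assume G: "\<forall>k\<in>K. G k \<in> Obj (Gam small)"
    then have "\<exists>I \<pi>. is_coproduct (Sets small) K (\<lambda>k. players (G k)) I \<pi>"
      "\<exists>O' \<rho>. is_coproduct (Sets small) K (\<lambda>k. outcomes (G k)) O' \<rho>"
      using has_coproducts_Sets[OF that] by (auto simp: has_coproducts_def)
    then show "\<exists>S \<iota>. is_coproduct (Gam small) K G S \<iota>"
      using is_coproduct_Gam[of K G] G by blast
  qed
  moreover have "has_equalizers (Gam small)"
    unfolding has_equalizers_def
  proof (intro ballI)
    fix a b f g
    assume a: "a \<in> Obj (Gam small)" and "b \<in> Obj (Gam small)"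
      and "f \<in> Hom (Gam small) a b" "g \<in> Hom (Gam small) a b"
    then have "\<exists>I \<pi>. is_equalizer (Sets small) (players a) (players b) (fst f) (fst g) I \<pi>"
      "\<exists>O' \<rho>. is_equalizer (Sets small) (outcomes a) (outcomes b) (snd f) (snd g) O' \<rho>"
      using has_equalizers_Sets by (simp_all add: has_equalizers_def game_homD)
    then show "\<exists>E e. is_equalizer (Gam small) a b f g E e"
      using is_equalizer_Gam[OF a] by blast
  qed
  moreover have "has_coequalizers (Gam small)"
    unfolding has_coequalizers_def
  proof (intro ballI)
    fix a b f g
    assume "a \<in> Obj (Gam small)" and b: "b \<in> Obj (Gam small)"
      and "f \<in> Hom (Gam small) a b" "g \<in> Hom (Gam small) a b"
    then have "\<exists>I \<pi>. is_coequalizer (Sets small) (players a) (players b) (fst f) (fst g) I \<pi>"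
      "\<exists>O' \<rho>. is_coequalizer (Sets small) (outcomes a) (outcomes b) (snd f) (snd g) O' \<rho>"
      using has_coequalizers_Sets by (simp_all add: has_coequalizers_def game_homD)
    then show "\<exists>Q q. is_coequalizer (Gam small) a b f g Q q"
      using is_coequalizer_Gam[OF b] by blast
  qed
  ultimately show ?thesis
    by (simp add: complete_category_def cocomplete_category_def)
qed

end
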